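(* For every uncountable regular cardinal number $\kappa$, the class of $\kappa$-Corson compact spaces is stable under continuous images; that is, if $K$ is a $\kappa$-Corson compact space and $f:K\to L$ is a continuous surjection onto a Hausdorff space $L$, then $L$ is $\kappa$-Corson compact.
   Context: For an infinite cardinal $\kappa$ and a set $\Gamma$, $\Sigma_\kappa(\mathbb{R}^\Gamma)=\{x\in\mathbb{R}^\Gamma:\ |\{\gamma\in\Gamma:x(\gamma)\neq0\}|<\kappa\}$ with the topology inherited from the product. A compact (Hausdorff) space is $\kappa$-Corson compact if it is homeomorphic to a subset of $\Sigma_\kappa(\mathbb{R}^\Gamma)$ for some set $\Gamma$. *)

theory Defs
  imports "HOL-Analysis.Analysis"
begin

unbundle cardinal_syntax

text \<open>
  Cardinals are well-order relations as in HOL's cardinal library, so \<open>\<kappa>\<close> may live on any type.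
  Points of \<open>\<real>\<^sup>\<Gamma>\<close> are, as usual for \<^const>\<open>product_topology\<close>, the extensional functions on \<open>\<Gamma>\<close>.
\<close>

definition Sigma_prod :: "'k rel \<Rightarrow> 'i set \<Rightarrow> ('i \<Rightarrow> real) set" where
  "Sigma_prod \<kappa> \<Gamma> = {x \<in> \<Gamma> \<rightarrow>\<^sub>E UNIV. |{\<gamma> \<in> \<Gamma>. x \<gamma> \<noteq> 0}| <o \<kappa>}"

definition Sigma_space :: "'k rel \<Rightarrow> 'i set \<Rightarrow> ('i \<Rightarrow> real) topology" where
  "Sigma_space \<kappa> \<Gamma> = subtopology (product_topology (\<lambda>_. euclideanreal) \<Gamma>) (Sigma_prod \<kappa> \<Gamma>)"

text \<open>
  A definition cannot quantify over the type of the index set \<open>\<Gamma>\<close>. For a space on \<open>'a\<close> we take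
  \<open>\<Gamma>\<close> to be a set of functions \<open>'a \<Rightarrow> real\<close>, which loses no generality: lemma
  \<open>kappa_Corson_compactI\<close> below accepts index sets of arbitrary type.
\<close>

definition kappa_Corson_compact :: "'k rel \<Rightarrow> 'a topology \<Rightarrow> bool" where
  "kappa_Corson_compact \<kappa> X \<longleftrightarrow>
     compact_space X \<and> Hausdorff_space X \<and>
     (\<exists>(\<Gamma> :: ('a \<Rightarrow> real) set) S. S \<subseteq> topspace (Sigma_space \<kappa> \<Gamma>) \<and>
        X homeomorphic_space subtopology (Sigma_space \<kappa> \<Gamma>) S)"

lemma topspace_Sigma_space: "topspace (Sigma_space \<kappa> \<Gamma>) = Sigma_prod \<kappa> \<Gamma>"
  by (auto simp: Sigma_space_def Sigma_prod_def)

lemma kappa_Corson_compactI: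
  fixes X :: "'a topology" and \<Gamma> :: "'i set"
  assumes "compact_space X" and "Hausdorff_space X"
    and S: "S \<subseteq> topspace (Sigma_space \<kappa> \<Gamma>)"
    and hom: "X homeomorphic_space subtopology (Sigma_space \<kappa> \<Gamma>) S"
  shows "kappa_Corson_compact \<kappa> X"
proof -
  obtain h where h: "homeomorphic_map X (subtopology (Sigma_space \<kappa> \<Gamma>) S) h"
    using hom by (auto simp: homeomorphic_space)
  have hS: "h x \<in> Sigma_prod \<kappa> \<Gamma>" if "x \<in> topspace X" for x
    using homeomorphic_imp_surjective_map[OF h] that S
    by (auto simp: topspace_Sigma_space)
  have inj: "inj_on h (topspace X)"
    using homeomorphic_imp_injective_map[OF h] .
  have "continuous_map X (product_topology (\<lambda>_. euclideanreal) \<Gamma>) h"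
    using homeomorphic_imp_continuous_map[OF h]
    by (simp add: Sigma_space_def subtopology_subtopology continuous_map_in_subtopology)
  then have cont: "continuous_map X euclideanreal (\<lambda>x. h x \<gamma>)" if "\<gamma> \<in> \<Gamma>" for \<gamma>
    using that by (simp add: continuous_map_componentwise)
  define c where "c = (\<lambda>\<gamma> x. h x \<gamma>)"
  define \<Delta> where "\<Delta> = c ` \<Gamma>"
  define g where "g = (\<lambda>x. \<lambda>\<phi>\<in>\<Delta>. \<phi> x)"
  have gS: "g x \<in> Sigma_prod \<kappa> \<Delta>" if "x \<in> topspace X" for x
  proof -
    have "{\<phi> \<in> \<Delta>. g x \<phi> \<noteq> 0} = c ` {\<gamma> \<in> \<Gamma>. h x \<gamma> \<noteq> 0}"
      by (auto simp: g_def \<Delta>_def c_def)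
    then have "|{\<phi> \<in> \<Delta>. g x \<phi> \<noteq> 0}| \<le>o |{\<gamma> \<in> \<Gamma>. h x \<gamma> \<noteq> 0}|"
      by (metis card_of_image)
    moreover have "|{\<gamma> \<in> \<Gamma>. h x \<gamma> \<noteq> 0}| <o \<kappa>"
      using hS[OF that] by (simp add: Sigma_prod_def)
    ultimately have "|{\<phi> \<in> \<Delta>. g x \<phi> \<noteq> 0}| <o \<kappa>"
      by (rule ordLeq_ordLess_trans)
    moreover have "g x \<in> \<Delta> \<rightarrow>\<^sub>E UNIV"
      by (simp add: g_def)
    ultimately show ?thesis
      unfolding Sigma_prod_def by blast
  qed
  have gcont: "continuous_map X (product_topology (\<lambda>_. euclideanreal) \<Delta>) g"
    unfolding continuous_map_componentwise
    by (auto simp: g_def \<Delta>_def c_def cont)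
  then have gcont': "continuous_map X (Sigma_space \<kappa> \<Delta>) g"
    using gS by (auto simp: Sigma_space_def continuous_map_in_subtopology)
  have ginj: "inj_on g (topspace X)"
  proof (rule inj_onI)
    fix x y assume x: "x \<in> topspace X" and y: "y \<in> topspace X" and eq: "g x = g y"
    have "h x \<gamma> = h y \<gamma>" if "\<gamma> \<in> \<Gamma>" for \<gamma>
      using fun_cong[OF eq, of "c \<gamma>"] that by (simp add: g_def \<Delta>_def c_def)
    then have "h x = h y"
      using hS[OF x] hS[OF y] by (auto simp: Sigma_prod_def intro: PiE_ext)
    then show "x = y" using inj x y by (auto dest: inj_onD)
  qed
  have "Hausdorff_space (Sigma_space \<kappa> \<Delta>)"
    by (auto simp: Sigma_space_def Hausdorff_space_product_topology
        intro!: Hausdorff_space_subtopology)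
  then have "embedding_map X (Sigma_space \<kappa> \<Delta>) g"
    using continuous_imp_embedding_map gcont' ginj assms(1) by blast
  then have "X homeomorphic_space subtopology (Sigma_space \<kappa> \<Delta>) (g ` topspace X)"
    by (meson embedding_map_def homeomorphic_map_imp_homeomorphic_space)
  moreover have "g ` topspace X \<subseteq> topspace (Sigma_space \<kappa> \<Delta>)"
    using gS by (auto simp: topspace_Sigma_space)
  ultimately show ?thesis
    using assms(1,2) unfolding kappa_Corson_compact_def by blast
qed

end

theory Submission
  imports Defs
begin

text \<open>
  Regard \<open>K\<close> as a compact set \<open>C\<close> of functions with support of size less than \<open>\<kappa>\<close>, and let \<open>E\<close> be
  the closed equivalence relation \<open>f x = f y\<close> on \<open>C\<close>. For every finite set \<open>F\<close> of coordinates and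
  every \<open>n\<close> take a finite subset of \<open>E\<close> that is \<open>1/n\<close>-dense in \<open>E\<close> on the coordinates in \<open>F\<close>; let
  \<open>gen F\<close> be the union of the supports that occur. If a set \<open>A\<close> of coordinates is closed under \<open>gen\<close>,
  then restricting the support to \<open>A\<close> maps \<open>E\<close> into itself, because \<open>E\<close> is compact. So \<open>A\<close> induces
  a retraction of \<open>L\<close>.

  By induction on \<open>|A|\<close>, such a set \<open>A\<close> has a family of continuous \<open>E\<close>-invariant functions, fewer than
  \<open>\<kappa>\<close> of them nonzero at each point, that separates the images of the retraction. If \<open>|A| < \<kappa>\<close>, fewer
  than \<open>\<kappa>\<close> functions are enough. Otherwise \<open>A\<close> is a continuous increasing union of closed sets
  \<open>A\<^sub>i\<close> of smaller size, and one takes the functions \<open>u (x|A\<^bsub>i+1\<^esub>) - u (x|A\<^sub>i)\<close> with \<open>u\<close> in the family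
  of \<open>A\<^bsub>i+1\<^esub>\<close>. For a given \<open>x\<close> only the indices \<open>i\<close> for which the support of \<open>x\<close> meets
  \<open>A\<^bsub>i+1\<^esub> - A\<^sub>i\<close> matter, and there are fewer than \<open>\<kappa>\<close> of them.
\<close>

section \<open>Regular uncountable cardinals and finitary closure\<close>

locale uncountable_regular =
  fixes \<kappa> :: "'k rel"
  assumes Card_order: "Card_order \<kappa>"
    and uncountable: "natLeq <o \<kappa>"
    and regular: "regularCard \<kappa>"
begin

lemma Cinfinite: "Cinfinite \<kappa>"
proof -
  have "Cinfinite natLeq" by (rule natLeq_Cinfinite)
  then show ?thesis
    using Card_order cinfinite_mono ordLess_imp_ordLeq uncountable by blast
qed

lemma infinite_Field: "infinite (Field \<kappa>)"
  using Cinfinite by (simp add: cinfinite_def)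

text \<open>Regularity of \<kappa> enters in this form: an infinite regular cardinal is stable under
  unions. As \<kappa> is uncountable, countable unions are covered as well.\<close>

lemma UN_less:
  assumes "|I| <o \<kappa>" and "\<And>i. i \<in> I \<Longrightarrow> |A i| <o \<kappa>"
  shows "|\<Union>i\<in>I. A i| <o \<kappa>"
  using stable_UNION[OF regularCard_stable[OF Card_order infinite_Field regular]] assms by blast

lemma subset_less: "A \<subseteq> B \<Longrightarrow> |B| <o \<kappa> \<Longrightarrow> |A| <o \<kappa>"
  using card_of_mono1 ordLeq_ordLess_trans by blast

lemma image_less: "|A| <o \<kappa> \<Longrightarrow> |f ` A| <o \<kappa>"
  using card_of_image ordLeq_ordLess_trans by blast

lemma Un_less: "|A| <o \<kappa> \<Longrightarrow> |B| <o \<kappa> \<Longrightarrow> |A \<union> B| <o \<kappa>"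
  using card_of_Un_ordLess_infinite_Field[OF infinite_Field Card_order] .

lemma countable_less:
  assumes "countable S"
  shows "|S| <o \<kappa>"
proof -
  have "|S| \<le>o |UNIV :: nat set|"
    using assms by (metis countableE card_of_ordLeq subset_UNIV)
  then have "|S| \<le>o natLeq"
    using card_of_nat ordLeq_ordIso_trans by blast
  then show ?thesis
    using uncountable ordLeq_ordLess_trans by blast
qed

lemma finite_less: "finite S \<Longrightarrow> |S| <o \<kappa>"
  by (simp add: countable_less countable_finite)

text \<open>Sort the finite subsets by size. Those with n + 1 elements arise by inserting one of
  fewer than \<kappa> elements into one with n elements, and the countable union over n stays below
  \<kappa>.\<close>

lemma Fpow_less:
  assumes "|X| <o \<kappa>"
  shows "|Fpow X| <o \<kappa>"
proof -
  define S where "S = (\<lambda>n. {F \<in> Fpow X. card F = n})"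
  have "|S n| <o \<kappa>" for n
  proof (induction n)
    case 0
    have "S 0 \<subseteq> {{}}" by (auto simp: S_def Fpow_def)
    then show ?case by (meson finite_less finite.intros subset_less)
  next
    case (Suc n)
    have "S (Suc n) \<subseteq> (\<Union>a\<in>X. insert a ` S n)"
    proof
      fix F assume F: "F \<in> S (Suc n)"
      then obtain a G where "F = insert a G" "a \<notin> G" "card G = n"
        by (auto simp: S_def card_Suc_eq)
      with F show "F \<in> (\<Union>a\<in>X. insert a ` S n)"
        by (auto simp: S_def Fpow_def)
    qed
    moreover have "|\<Union>a\<in>X. insert a ` S n| <o \<kappa>"
      using assms Suc by (intro UN_less image_less)
    ultimately show ?case by (rule subset_less)
  qed
  then have "|\<Union>n. S n| <o \<kappa>"
    by (intro UN_less) (auto simp: countable_less)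
  moreover have "Fpow X = (\<Union>n. S n)" by (auto simp: S_def)
  ultimately show ?thesis by simp
qed

end

lemma uncountable_regular_cardSuc:
  assumes "Cinfinite r"
  shows "uncountable_regular (cardSuc r)"
proof
  show "Card_order (cardSuc r)" using assms by (simp add: cardSuc_Card_order)
  have "natLeq \<le>o r" using assms by (simp add: natLeq_ordLeq_cinfinite)
  moreover have "r <o cardSuc r" using assms by (simp add: cardSuc_greater)
  ultimately show "natLeq <o cardSuc r" by (rule ordLeq_ordLess_trans)
  show "regularCard (cardSuc r)" using assms by (rule regularCard_cardSuc)
qed

section \<open>Sets closed under a finitary operation\<close>

definition Fclosed :: "('i set \<Rightarrow> 'i set) \<Rightarrow> 'i set \<Rightarrow> bool" where
  "Fclosed G A \<longleftrightarrow> (\<forall>F. finite F \<longrightarrow> F \<subseteq> A \<longrightarrow> G F \<subseteq> A)"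

definition Fhull :: "('i set \<Rightarrow> 'i set) \<Rightarrow> 'i set \<Rightarrow> 'i set" where
  "Fhull G X = \<Inter>{A. X \<subseteq> A \<and> Fclosed G A}"

lemma Fclosed_Fhull: "Fclosed G (Fhull G X)"
  unfolding Fclosed_def Fhull_def
proof (intro allI impI, rule Inter_greatest)
  fix F A
  assume F: "finite F" "F \<subseteq> \<Inter>{A. X \<subseteq> A \<and> (\<forall>F. finite F \<longrightarrow> F \<subseteq> A \<longrightarrow> G F \<subseteq> A)}"
    and A: "A \<in> {A. X \<subseteq> A \<and> (\<forall>F. finite F \<longrightarrow> F \<subseteq> A \<longrightarrow> G F \<subseteq> A)}"
  from F(2) A have "F \<subseteq> A" by (rule order_trans[OF _ Inter_lower])
  with F(1) A show "G F \<subseteq> A" by simp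
qed

lemma subset_Fhull: "X \<subseteq> Fhull G X"
  by (auto simp: Fhull_def)

lemma Fhull_minimal: "X \<subseteq> A \<Longrightarrow> Fclosed G A \<Longrightarrow> Fhull G X \<subseteq> A"
  by (auto simp: Fhull_def)

lemma Fhull_mono: "X \<subseteq> Y \<Longrightarrow> Fhull G X \<subseteq> Fhull G Y"
  by (auto simp: Fhull_def)

lemma finite_subset_directed_Union:
  assumes "finite F" and "F \<subseteq> (\<Union>j\<in>J. B j)" and "J \<noteq> {}"
    and "\<And>i j. i \<in> J \<Longrightarrow> j \<in> J \<Longrightarrow> \<exists>k\<in>J. B i \<union> B j \<subseteq> B k"
  shows "\<exists>j\<in>J. F \<subseteq> B j"
  using assms(1,2)
proof (induction F)
  case empty
  then show ?case using assms(3) by auto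
next
  case (insert a F)
  then obtain i j where "i \<in> J" "F \<subseteq> B i" "j \<in> J" "a \<in> B j" by auto
  then show ?case using assms(4)[of i j] by blast
qed

text \<open>A finite subset of a directed union already lies in one member. Closure is defined
  through finite sets so that it survives the limit steps of a chain.\<close>

lemma Fclosed_directed_Union:
  assumes "\<And>j. j \<in> J \<Longrightarrow> Fclosed G (B j)" and "J \<noteq> {}"
    and "\<And>i j. i \<in> J \<Longrightarrow> j \<in> J \<Longrightarrow> \<exists>k\<in>J. B i \<union> B j \<subseteq> B k"
  shows "Fclosed G (\<Union>j\<in>J. B j)"
  unfolding Fclosed_def
proof (intro allI impI)
  fix F assume F: "finite F" "F \<subseteq> (\<Union>j\<in>J. B j)"
  from finite_subset_directed_Union[OF this assms(2,3)]
  obtain j where "j \<in> J" "F \<subseteq> B j" by blast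
  then show "G F \<subseteq> (\<Union>j\<in>J. B j)"
    using assms(1) F(1) unfolding Fclosed_def by blast
qed

text \<open>The stages \<open>H n\<close>, each adding \<open>G F\<close> for all finite
  \<open>F\<close> inside the previous one, have a closed union, which therefore contains the hull.
  Every stage is smaller than \<kappa> by \<open>Fpow_less\<close>, hence so is the countable
  union.\<close>

lemma (in uncountable_regular) Fhull_less:
  assumes G: "\<And>F. finite F \<Longrightarrow> |G F| <o \<kappa>" and X: "|X| <o \<kappa>"
  shows "|Fhull G X| <o \<kappa>"
proof -
  define H where "H = (\<lambda>n. ((\<lambda>Y. Y \<union> (\<Union>F\<in>Fpow Y. G F)) ^^ n) X)"
  have H0: "H 0 = X" and HS: "H (Suc n) = H n \<union> (\<Union>F\<in>Fpow (H n). G F)" for n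
    by (auto simp: H_def)
  have mono: "H m \<subseteq> H n" if "m \<le> n" for m n
    using that by (rule lift_Suc_mono_le[rotated]) (auto simp: HS)
  have "Fclosed G (\<Union>n. H n)"
    unfolding Fclosed_def
  proof (intro allI impI)
    fix F assume F: "finite F" "F \<subseteq> (\<Union>n. H n)"
    have "\<exists>n\<in>UNIV. F \<subseteq> H n"
    proof (rule finite_subset_directed_Union[OF F])
      show "\<exists>k\<in>UNIV. H i \<union> H j \<subseteq> H k" for i j
        using mono[of i "max i j"] mono[of j "max i j"] by auto
    qed auto
    then obtain n where "F \<subseteq> H n" by auto
    then have "G F \<subseteq> H (Suc n)" using F(1) unfolding HS Fpow_def by blast
    then show "G F \<subseteq> (\<Union>n. H n)" by blast
  qed
  moreover have "X \<subseteq> (\<Union>n. H n)" using H0 by blast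
  ultimately have "Fhull G X \<subseteq> (\<Union>n. H n)" by (rule Fhull_minimal[rotated])
  moreover have "|H n| <o \<kappa>" for n
  proof (induction n)
    case 0
    then show ?case by (simp add: H0 X)
  next
    case (Suc n)
    then show ?case unfolding HS
      by (intro Un_less UN_less Fpow_less) (auto simp: Fpow_def intro: G)
  qed
  then have "|\<Union>n. H n| <o \<kappa>"
    by (intro UN_less) (auto simp: countable_less)
  ultimately show ?thesis by (rule subset_less)
qed

text \<open>
  Here \<open>|A|\<close> may be singular. The bound comes from the regular cardinal \<open>cardSuc |X|\<close>.
\<close>
lemma (in uncountable_regular) Fhull_less_large:
  assumes G: "\<And>F. finite F \<Longrightarrow> |G F| <o \<kappa>" and A: "\<kappa> \<le>o |A|" and X: "|X| <o |A|"
  shows "|Fhull G X| <o |A|"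
proof (cases "|X| <o \<kappa>")
  case True
  with G have "|Fhull G X| <o \<kappa>" by (rule Fhull_less)
  then show ?thesis using A by (rule ordLess_ordLeq_trans)
next
  case False
  then have \<kappa>X: "\<kappa> \<le>o |X|"
    by (rule iffD1[OF not_ordLess_iff_ordLeq
          [OF card_order_on_well_order_on[OF Card_order] card_of_Well_order]])
  then have "Cinfinite |X|"
    using cinfinite_mono[OF \<kappa>X] Cinfinite card_of_Card_order by simp
  then interpret X: uncountable_regular "cardSuc |X|" by (rule uncountable_regular_cardSuc)
  have X_less: "|X| <o cardSuc |X|" by (simp add: cardSuc_greater card_of_Card_order)
  have "|G F| <o cardSuc |X|" if "finite F" for F
    by (rule ordLess_transitive[OF ordLess_ordLeq_trans[OF G[OF that] \<kappa>X] X_less])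
  then have "|Fhull G X| <o cardSuc |X|"
    using X_less by (rule X.Fhull_less)
  then have "|Fhull G X| \<le>o |X|"
    by (simp add: cardSuc_ordLeq_ordLess card_of_Card_order)
  then show ?thesis
    using X by (rule ordLeq_ordLess_trans)
qed

section \<open>Functions with the topology of pointwise convergence\<close>

lemma open_fun_contains_box:
  fixes x :: "'i \<Rightarrow> real"
  assumes "open W" and "x \<in> W"
  obtains F \<epsilon> where "finite F" "\<epsilon> > 0" "\<And>a. (\<And>i. i \<in> F \<Longrightarrow> \<bar>a i - x i\<bar> < \<epsilon>) \<Longrightarrow> a \<in> W"
proof -
  have "openin (product_topology (\<lambda>_. euclidean) UNIV) W"
    using assms(1) by (simp add: open_fun_def)
  from product_topology_open_contains_basis[OF this assms(2)]
  obtain X where X: "\<And>i. x i \<in> X i" "\<And>i. open (X i)" "finite {i. X i \<noteq> UNIV}"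
    "(\<Pi>\<^sub>E i\<in>UNIV. X i) \<subseteq> W"
    by (auto simp: PiE_iff)
  have "\<exists>e>0. \<forall>r. \<bar>r - x i\<bar> < e \<longrightarrow> r \<in> X i" for i
    using X(1,2)[of i] by (metis open_dist dist_real_def)
  then obtain e where e: "\<And>i. e i > 0" "\<And>i r. \<bar>r - x i\<bar> < e i \<Longrightarrow> r \<in> X i"
    by metis
  let ?F = "{i. X i \<noteq> UNIV}"
  \<comment> \<open>The \<open>1\<close> keeps the minimum defined and positive when no coordinate
    is constrained.\<close>
  let ?\<epsilon> = "Min (insert 1 (e ` ?F))"
  show thesis
  proof
    show "finite ?F" by (fact X(3))
    show "?\<epsilon> > 0" using X(3) e(1) by (subst Min_gr_iff) auto
    fix a assume a: "\<And>i. i \<in> ?F \<Longrightarrow> \<bar>a i - x i\<bar> < ?\<epsilon>"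
    have "a i \<in> X i" for i
    proof (cases "i \<in> ?F")
      case True
      then have "?\<epsilon> \<le> e i" using X(3) by (intro Min_le) auto
      with a[OF True] show ?thesis by (intro e(2)) simp
    qed simp
    then show "a \<in> W" using X(4) by (auto simp: PiE_iff)
  qed
qed

text \<open>Compact sets are closed for pointwise convergence. If (x, y) is outside
  \<open>E\<close>, the open sets \<open>V (i, n)\<close> of pairs farther than 1/(n+1) from (x, y)
  in coordinate i cover \<open>E\<close>. A finite subcover involves finitely many coordinates and
  tolerances, which contradicts \<open>approx\<close>.\<close>

lemma compact_pair_memberI:
  fixes E :: "(('i \<Rightarrow> real) \<times> ('i \<Rightarrow> real)) set"
  assumes "compact E"
    and approx: "\<And>F \<epsilon>. finite F \<Longrightarrow> \<epsilon> > 0 \<Longrightarrow>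
      \<exists>(a, b)\<in>E. \<forall>i\<in>F. \<bar>a i - x i\<bar> < \<epsilon> \<and> \<bar>b i - y i\<bar> < \<epsilon>"
  shows "(x, y) \<in> E"
proof (rule ccontr)
  assume xy: "(x, y) \<notin> E"
  define V where "V = (\<lambda>(i, n). {p. 1 / real (Suc n) < \<bar>fst p i - x i\<bar>} \<union> {p. 1 / real (Suc n) < \<bar>snd p i - y i\<bar>})"
  have openV: "open (V k)" for k
    unfolding V_def case_prod_beta
    by (intro open_Un open_Collect_less continuous_intros
        continuous_on_product_then_coordinatewise[OF continuous_on_fst]
        continuous_on_product_then_coordinatewise[OF continuous_on_snd])
  have coverV: "E \<subseteq> (\<Union>k. V k)"
  proof
    fix p assume "p \<in> E"
    with xy have "p \<noteq> (x, y)" by auto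
    then obtain i where "fst p i \<noteq> x i \<or> snd p i \<noteq> y i" by (auto simp: prod_eq_iff)
    then have "max \<bar>fst p i - x i\<bar> \<bar>snd p i - y i\<bar> > 0" by auto
    then obtain n where "1 / real (Suc n) < max \<bar>fst p i - x i\<bar> \<bar>snd p i - y i\<bar>"
      using nat_approx_posE by blast
    then have "p \<in> V (i, n)" by (auto simp: V_def)
    then show "p \<in> (\<Union>k. V k)" by blast
  qed
  obtain D where D: "finite D" "E \<subseteq> (\<Union>k\<in>D. V k)"
    by (rule compactE_image[OF assms(1) openV coverV])
  \<comment> \<open>\<open>m\<close> bounds every n in the subcover, so \<open>1 / Suc m\<close> is
    at most each of its tolerances. The \<open>0\<close> covers an empty \<open>D\<close>.\<close>
  define m where "m = Max (insert 0 (snd ` D))"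
  obtain a b where ab: "(a, b) \<in> E"
    "\<And>i. i \<in> fst ` D \<Longrightarrow> \<bar>a i - x i\<bar> < 1 / Suc m \<and> \<bar>b i - y i\<bar> < 1 / Suc m"
    using approx[of "fst ` D" "1 / Suc m"] D(1) by auto
  then obtain i n where "(i, n) \<in> D" "(a, b) \<in> V (i, n)"
    using D(2) by (metis UN_E prod.exhaust subsetD)
  moreover have "n \<le> m"
    unfolding m_def using D(1) \<open>(i, n) \<in> D\<close> by (intro Max_ge) force+
  then have "1 / Suc m \<le> 1 / real (Suc n)" by (simp add: frac_le)
  moreover have "i \<in> fst ` D" using \<open>(i, n) \<in> D\<close> by force
  ultimately show False using ab(2)[of i] by (auto simp: V_def)
qed

lemma continuous_on_fun_contains_box:
  fixes h :: "('i \<Rightarrow> real) \<Rightarrow> real"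
  assumes "continuous_on C h" and "x \<in> C" and "\<epsilon> > 0"
  obtains F \<delta> where "finite F" "\<delta> > 0"
    "\<And>a. a \<in> C \<Longrightarrow> (\<And>i. i \<in> F \<Longrightarrow> \<bar>a i - x i\<bar> < \<delta>) \<Longrightarrow> \<bar>h a - h x\<bar> < \<epsilon>"
proof -
  obtain W where W: "open W" "x \<in> W" "\<And>a. a \<in> C \<Longrightarrow> a \<in> W \<Longrightarrow> h a \<in> ball (h x) \<epsilon>"
    using assms unfolding continuous_on_topological by (metis centre_in_ball open_ball)
  obtain F \<delta> where F: "finite F" "\<delta> > 0" "\<And>a. (\<And>i. i \<in> F \<Longrightarrow> \<bar>a i - x i\<bar> < \<delta>) \<Longrightarrow> a \<in> W"
    using open_fun_contains_box[OF W(1,2)] by metis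
  show thesis
  proof
    show "\<bar>h a - h x\<bar> < \<epsilon>" if "a \<in> C" "\<And>i. i \<in> F \<Longrightarrow> \<bar>a i - x i\<bar> < \<delta>" for a
      using W(3)[OF that(1) F(3)[OF that(2)]] by (simp add: dist_real_def abs_minus_commute)
  qed (use F in auto)
qed

text \<open>The boxes of radius \<epsilon> about the points of \<open>E\<close> form an open cover;
  the centres of a finite subcover form \<open>D\<close>.\<close>

lemma compact_finite_net:
  fixes E :: "(('i \<Rightarrow> real) \<times> ('i \<Rightarrow> real)) set"
  assumes "compact E" and "finite F" and "\<epsilon> > 0"
  shows "\<exists>D. finite D \<and> D \<subseteq> E \<and>
    (\<forall>(x, y)\<in>E. \<exists>(a, b)\<in>D. \<forall>i\<in>F. \<bar>a i - x i\<bar> < \<epsilon> \<and> \<bar>b i - y i\<bar> < \<epsilon>)"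
proof -
  define B where "B = (\<lambda>d :: ('i \<Rightarrow> real) \<times> ('i \<Rightarrow> real).
    \<Inter>i\<in>F. {p. \<bar>fst d i - fst p i\<bar> < \<epsilon> \<and> \<bar>snd d i - snd p i\<bar> < \<epsilon>})"
  have "open (B d)" for d
    unfolding B_def
    by (intro open_INT assms(2) ballI open_Collect_conj open_Collect_less continuous_intros
        continuous_on_product_then_coordinatewise[OF continuous_on_fst]
        continuous_on_product_then_coordinatewise[OF continuous_on_snd])
  moreover have "E \<subseteq> (\<Union>d\<in>E. B d)"
    using assms(3) by (auto simp: B_def)
  ultimately obtain D where "D \<subseteq> E" "finite D" "E \<subseteq> (\<Union>d\<in>D. B d)"
    using compactE_image[OF assms(1), of E B] by blast
  then show ?thesis
    by (intro exI[of _ D]) (fastforce simp: B_def)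
qed

text \<open>Coordinates outside \<open>A\<close> are set to zero instead of being dropped, so that
  the restriction of a point of \<open>C\<close> can again be a point of \<open>C\<close>.\<close>

definition restr :: "'i set \<Rightarrow> ('i \<Rightarrow> real) \<Rightarrow> 'i \<Rightarrow> real" where
  "restr A x = (\<lambda>i. if i \<in> A then x i else 0)"

lemma restr_idem: "restr A (restr A x) = restr A x"
  by (auto simp: restr_def)

lemma continuous_on_restr: "continuous_on S (restr A)"
proof (rule continuous_on_coordinatewise_then_product)
  fix i
  have "continuous_on S (\<lambda>x. x i :: real)"
    by (rule continuous_on_subset[OF continuous_on_product_coordinates]) simp
  then show "continuous_on S (\<lambda>x. restr A x i)"
    by (cases "i \<in> A") (simp_all add: restr_def)
qed

section \<open>Quotients of compact subsets of sigma-products\<close>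

text \<open>\<open>C\<close> will be a copy of \<open>K\<close> among real functions and
  \<open>E\<close> the relation of having the same image under \<open>f\<close>. The assumption
  \<open>separated\<close> expresses through functions that the quotient is Hausdorff; it will come
  from Urysohn's lemma on \<open>L\<close>.\<close>

locale sigma_quotient = uncountable_regular \<kappa>
  for \<kappa> :: "'k rel" +
  fixes C :: "('i \<Rightarrow> real) set" and E :: "(('i \<Rightarrow> real) \<times> ('i \<Rightarrow> real)) set"
  assumes compact_E: "compact E"
    and E_subset: "E \<subseteq> C \<times> C"
    and refl_E: "\<And>x. x \<in> C \<Longrightarrow> (x, x) \<in> E"
    and support_less: "\<And>x. x \<in> C \<Longrightarrow> |{i. x i \<noteq> 0}| <o \<kappa>"
    and separated: "\<And>x y. x \<in> C \<Longrightarrow> y \<in> C \<Longrightarrow> (x, y) \<notin> E \<Longrightarrow>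
      \<exists>h :: _ \<Rightarrow> real. continuous_on C h \<and> (\<forall>a b. (a, b) \<in> E \<longrightarrow> h a = h b) \<and> h x \<noteq> h y"
begin

section \<open>Coordinate sets whose restrictions respect the relation\<close>

definition net where
  "net F n = (SOME D. finite D \<and> D \<subseteq> E \<and>
    (\<forall>(x, y)\<in>E. \<exists>(a, b)\<in>D. \<forall>i\<in>F. \<bar>a i - x i\<bar> < 1 / Suc n \<and> \<bar>b i - y i\<bar> < 1 / Suc n))"

definition gen where
  "gen F = (\<Union>n. \<Union>(a, b)\<in>net F n. {i. a i \<noteq> 0} \<union> {i. b i \<noteq> 0})"

lemma net:
  assumes "finite F"
  shows "finite (net F n)" "net F n \<subseteq> E"
    "\<And>x y. (x, y) \<in> E \<Longrightarrow>
      \<exists>(a, b)\<in>net F n. \<forall>i\<in>F. \<bar>a i - x i\<bar> < 1 / Suc n \<and> \<bar>b i - y i\<bar> < 1 / Suc n"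
proof -
  have "1 / real (Suc n) > 0" by simp
  from someI_ex[OF compact_finite_net[OF compact_E assms this], folded net_def]
  show "finite (net F n)" "net F n \<subseteq> E"
    "\<And>x y. (x, y) \<in> E \<Longrightarrow>
      \<exists>(a, b)\<in>net F n. \<forall>i\<in>F. \<bar>a i - x i\<bar> < 1 / Suc n \<and> \<bar>b i - y i\<bar> < 1 / Suc n"
    by blast+
qed

lemma gen_less:
  assumes "finite F"
  shows "|gen F| <o \<kappa>"
  unfolding gen_def
proof (intro UN_less)
  show "|UNIV :: nat set| <o \<kappa>" by (simp add: countable_less)
  fix n
  show "|net F n| <o \<kappa>" using net(1)[OF assms] by (rule finite_less)
  fix p assume "p \<in> net F n"
  then have "p \<in> C \<times> C" using net(2)[OF assms] E_subset by blast
  then have "fst p \<in> C" "snd p \<in> C" by (auto simp: mem_Times_iff)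
  then show "|case p of (a, b) \<Rightarrow> {i. a i \<noteq> 0} \<union> {i. b i \<noteq> 0}| <o \<kappa>"
    by (auto simp: case_prod_beta intro: Un_less support_less)
qed

text \<open>A net pair (a, b) for \<open>F \<inter> A\<close> is close to (x, y) there, and its
  supports lie in \<open>gen (F \<inter> A) \<subseteq> A\<close>. Outside \<open>A\<close> both a
  and b vanish, as the restrictions do. So (a, b) approximates the restricted pair on all of
  \<open>F\<close>, and compactness of \<open>E\<close> finishes.\<close>

lemma restr_in_E:
  assumes "Fclosed gen A" and "(x, y) \<in> E"
  shows "(restr A x, restr A y) \<in> E"
proof (rule compact_pair_memberI[OF compact_E])
  fix F :: "'i set" and \<epsilon> :: real assume "finite F" "\<epsilon> > 0"
  then have fin: "finite (F \<inter> A)" by simp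
  obtain n where n: "1 / Suc n < \<epsilon>"
    using \<open>\<epsilon> > 0\<close> nat_approx_posE by blast
  obtain a b where ab: "(a, b) \<in> net (F \<inter> A) n"
    "\<forall>i\<in>F \<inter> A. \<bar>a i - x i\<bar> < 1 / Suc n \<and> \<bar>b i - y i\<bar> < 1 / Suc n"
    using net(3)[OF fin assms(2)] by blast
  have "gen (F \<inter> A) \<subseteq> A"
    using assms(1) fin unfolding Fclosed_def by blast
  moreover have "{i. a i \<noteq> 0} \<union> {i. b i \<noteq> 0} \<subseteq> gen (F \<inter> A)"
    using ab(1) unfolding gen_def by blast
  ultimately have "a i = 0" "b i = 0" if "i \<notin> A" for i
    using that by blast+
  then have "\<forall>i\<in>F. \<bar>a i - restr A x i\<bar> < \<epsilon> \<and> \<bar>b i - restr A y i\<bar> < \<epsilon>"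
    using ab(2) n \<open>\<epsilon> > 0\<close> by (force simp: restr_def)
  moreover have "(a, b) \<in> E" using ab(1) net(2)[OF fin] by blast
  ultimately show "\<exists>(a, b)\<in>E. \<forall>i\<in>F. \<bar>a i - restr A x i\<bar> < \<epsilon> \<and> \<bar>b i - restr A y i\<bar> < \<epsilon>"
    by blast
qed

lemma restr_in_C: "Fclosed gen A \<Longrightarrow> x \<in> C \<Longrightarrow> restr A x \<in> C"
  using restr_in_E[of A x x] refl_E E_subset by blast

text \<open>On a finite set of coordinates the restriction to the union agrees with the restriction
  to a single \<open>B j\<close>. This is the limit step for chains of coordinate sets.\<close>

lemma restr_directed_Union_in_E:
  assumes E: "\<And>j. j \<in> J \<Longrightarrow> (restr (B j) x, restr (B j) y) \<in> E" and "J \<noteq> {}"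
    and dir: "\<And>i j. i \<in> J \<Longrightarrow> j \<in> J \<Longrightarrow> \<exists>k\<in>J. B i \<union> B j \<subseteq> B k"
  shows "(restr (\<Union>j\<in>J. B j) x, restr (\<Union>j\<in>J. B j) y) \<in> E"
proof (rule compact_pair_memberI[OF compact_E])
  let ?B = "\<Union>j\<in>J. B j"
  fix F :: "'i set" and \<epsilon> :: real assume "finite F" "\<epsilon> > 0"
  have "\<exists>j\<in>J. F \<inter> ?B \<subseteq> B j"
  proof (rule finite_subset_directed_Union[OF _ _ \<open>J \<noteq> {}\<close> dir])
    show "finite (F \<inter> ?B)" using \<open>finite F\<close> by simp
  qed auto
  then obtain j where j: "j \<in> J" "F \<inter> ?B \<subseteq> B j" by blast
  then have "restr (B j) z i = restr ?B z i" if "i \<in> F" for z i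
    using that by (auto simp: restr_def)
  with \<open>\<epsilon> > 0\<close> E[OF j(1)]
  show "\<exists>(a, b)\<in>E. \<forall>i\<in>F. \<bar>a i - restr ?B x i\<bar> < \<epsilon> \<and> \<bar>b i - restr ?B y i\<bar> < \<epsilon>"
    by (intro bexI[of _ "(restr (B j) x, restr (B j) y)"]) auto
qed

section \<open>Point-small separating families of functions on the quotient\<close>

definition invariant_fun :: "(('i \<Rightarrow> real) \<Rightarrow> real) \<Rightarrow> bool" where
  "invariant_fun u \<longleftrightarrow> continuous_on C u \<and> (\<forall>x y. (x, y) \<in> E \<longrightarrow> u x = u y)"

lemma invariant_fun_comp_restr:
  assumes "Fclosed gen A" and "invariant_fun u"
  shows "invariant_fun (\<lambda>x. u (restr A x))"
proof -
  have "continuous_on C (u \<circ> restr A)"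
    using assms restr_in_C
    by (intro continuous_on_compose continuous_on_restr)
      (auto simp: invariant_fun_def intro: continuous_on_subset)
  then show ?thesis
    using assms restr_in_E[OF assms(1)] by (force simp: invariant_fun_def o_def)
qed

text \<open>The restrictions to \<open>A\<close> only decide which pairs must be separated; the
  functions are evaluated at the points themselves. For \<open>A = UNIV\<close> all pairs outside
  \<open>E\<close> are separated.\<close>

definition separating_family :: "'i set \<Rightarrow> (('i \<Rightarrow> real) \<Rightarrow> real) set \<Rightarrow> bool" where
  "separating_family A U \<longleftrightarrow> (\<forall>u\<in>U. invariant_fun u) \<and>
     (\<forall>x\<in>C. |{u \<in> U. u x \<noteq> 0}| <o \<kappa>) \<and>
     (\<forall>x\<in>C. \<forall>y\<in>C. (restr A x, restr A y) \<notin> E \<longrightarrow> (\<exists>u\<in>U. u x \<noteq> u y))"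

text \<open>There are fewer than \<kappa> tuples (F, n, d, d') with \<open>F\<close> a finite subset
  of \<open>A\<close> and d, d' first components of points of \<open>net F n\<close>. For each, one
  invariant function is chosen, if there is one, that separates the restricted points near d from
  those near d'. By continuity, every pair to be separated is caught by some tuple.\<close>

lemma separating_family_small:
  assumes A: "Fclosed gen A" and small: "|A| <o \<kappa>"
  shows "\<exists>U. separating_family A U"
proof -
  define near where "near = (\<lambda>F n (x :: 'i \<Rightarrow> real) d. \<forall>i\<in>F. \<bar>d i - x i\<bar> < 1 / Suc n)"
  define P where "P = (\<lambda>F n d d' u. invariant_fun u \<and>
    (\<forall>x\<in>C. \<forall>y\<in>C. restr A x = x \<longrightarrow> restr A y = y \<longrightarrow>
      near F n x d \<longrightarrow> near F n y d' \<longrightarrow> u x \<noteq> u y))"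
  define s where "s = (\<lambda>F n d d'. SOME u. P F n d d' u)"
  define U where "U = (\<Union>F\<in>Fpow A. \<Union>n. \<Union>d\<in>fst ` net F n. \<Union>d'\<in>{d' \<in> fst ` net F n. \<exists>u. P F n d d' u}.
    {\<lambda>x. s F n d d' (restr A x)})"
  have s: "P F n d d' (s F n d d')" if "P F n d d' u" for F n d d' u
    unfolding s_def using that by (rule someI[where P = "P F n d d'"])
  have "|U| <o \<kappa>"
    unfolding U_def
  proof (intro UN_less)
    show "|Fpow A| <o \<kappa>" using small by (rule Fpow_less)
    fix F n assume "F \<in> Fpow A"
    then have "finite (net F n)" by (intro net(1)) (auto simp: Fpow_def)
    then show "|fst ` net F n| <o \<kappa>"
      "|{d' \<in> fst ` net F n. \<exists>u. P F n d d' u}| <o \<kappa>" for d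
      by (auto intro: finite_less)
  qed (auto intro: countable_less finite_less)
  then have "|{u \<in> U. u x \<noteq> 0}| <o \<kappa>" for x
    by (rule subset_less[rotated]) auto
  moreover have "invariant_fun u" if "u \<in> U" for u
    using that s by (auto simp: U_def P_def intro!: invariant_fun_comp_restr[OF A])
  moreover have "\<exists>u\<in>U. u x \<noteq> u y"
    if x: "x \<in> C" and y: "y \<in> C" and xy: "(restr A x, restr A y) \<notin> E" for x y
  proof -
    have AC: "restr A x \<in> C" "restr A y \<in> C" using x y A by (auto intro: restr_in_C)
    then obtain h where h: "invariant_fun h" "h (restr A x) \<noteq> h (restr A y)"
      using separated[OF AC xy] unfolding invariant_fun_def by blast
    \<comment> \<open>With half the gap, values within \<epsilon> of the two ends cannot
      coincide.\<close>
    define \<epsilon> where "\<epsilon> = \<bar>h (restr A x) - h (restr A y)\<bar> / 2"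
    have "\<epsilon> > 0" and contC: "continuous_on C h" using h by (auto simp: \<epsilon>_def invariant_fun_def)
    from continuous_on_fun_contains_box[OF contC AC(1) \<open>\<epsilon> > 0\<close>]
    obtain F1 \<delta>1 where F1: "finite F1" "\<delta>1 > 0"
      "\<And>a. a \<in> C \<Longrightarrow> (\<And>i. i \<in> F1 \<Longrightarrow> \<bar>a i - restr A x i\<bar> < \<delta>1) \<Longrightarrow> \<bar>h a - h (restr A x)\<bar> < \<epsilon>"
      by metis
    from continuous_on_fun_contains_box[OF contC AC(2) \<open>\<epsilon> > 0\<close>]
    obtain F2 \<delta>2 where F2: "finite F2" "\<delta>2 > 0"
      "\<And>a. a \<in> C \<Longrightarrow> (\<And>i. i \<in> F2 \<Longrightarrow> \<bar>a i - restr A y i\<bar> < \<delta>2) \<Longrightarrow> \<bar>h a - h (restr A y)\<bar> < \<epsilon>"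
      by metis
    have "min \<delta>1 \<delta>2 / 2 > 0" using F1(2) F2(2) by simp
    \<comment> \<open>The factor 1/2 pays for the triangle inequality through the net point: two
      points near it are within \<open>min \<delta>1 \<delta>2\<close> of each other on
      \<open>F\<close>.\<close>
    then obtain n where n: "1 / Suc n < min \<delta>1 \<delta>2 / 2"
      using nat_approx_posE by blast
    define F where "F = (F1 \<union> F2) \<inter> A"
    have F: "finite F" "F \<in> Fpow A" using F1(1) F2(1) by (auto simp: F_def Fpow_def)
    \<comment> \<open>The net for \<open>E\<close> also serves for \<open>C\<close>: apply it to the
      diagonal pair and keep the first component.\<close>
    have "\<exists>d\<in>fst ` net F n. near F n (restr A z) d" if "restr A z \<in> C" for z
      using net(3)[OF F(1) refl_E[OF that]] unfolding near_def by force
    then obtain d d' where d: "d \<in> fst ` net F n" "near F n (restr A x) d"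
      and d': "d' \<in> fst ` net F n" "near F n (restr A y) d'"
      using AC by metis
    have close: "\<bar>a i - restr A z i\<bar> < min \<delta>1 \<delta>2"
      if "restr A a = a" "near F n a e" "near F n (restr A z) e" "i \<in> F1 \<union> F2" for a z e i
    proof (cases "i \<in> A")
      case True
      then have "i \<in> F" using that(4) by (simp add: F_def)
      then have "\<bar>e i - a i\<bar> < 1 / Suc n" "\<bar>e i - restr A z i\<bar> < 1 / Suc n"
        using that(2,3) by (auto simp: near_def)
      then show ?thesis using n by linarith
    next
      case False
      then have "a i = 0" using fun_cong[OF that(1), of i] by (simp add: restr_def)
      then show ?thesis using False F1(2) F2(2) by (simp add: restr_def)
    qed
    have "h a \<noteq> h b" if "a \<in> C" "b \<in> C" "restr A a = a" "restr A b = b"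
      "near F n a d" "near F n b d'" for a b
    proof -
      have "\<bar>h a - h (restr A x)\<bar> < \<epsilon>"
        using close[OF that(3,5) d(2)] by (intro F1(3) that(1)) auto
      moreover have "\<bar>h b - h (restr A y)\<bar> < \<epsilon>"
        using close[OF that(4,6) d'(2)] by (intro F2(3) that(2)) auto
      ultimately show ?thesis unfolding \<epsilon>_def by (auto simp: abs_if field_simps split: if_splits)
    qed
    then have "P F n d d' h" using h(1) by (auto simp: P_def)
    from s[OF this] have "s F n d d' (restr A x) \<noteq> s F n d d' (restr A y)"
      using AC d(2) d'(2) restr_idem unfolding P_def by blast
    moreover have "(\<lambda>x. s F n d d' (restr A x)) \<in> U"
      unfolding U_def
    proof (intro UN_I)
      show "d' \<in> {d' \<in> fst ` net F n. \<exists>u. P F n d d' u}"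
        using d'(1) \<open>P F n d d' h\<close> by blast
    qed (use F(2) d(1) in auto)
    ultimately show ?thesis by (rule bexI)
  qed
  ultimately show ?thesis unfolding separating_family_def by blast
qed

text \<open>The cardinal order on \<open>A\<close> has proper initial segments smaller than
  \<open>A\<close>, so their hulls form a chain to which \<open>IH\<close> applies. Two points are
  separated at the first step of the chain where their restrictions become inequivalent.\<close>

lemma separating_family_large:
  assumes A: "Fclosed gen A" and large: "\<kappa> \<le>o |A|"
    and IH: "\<And>B. Fclosed gen B \<Longrightarrow> |B| <o |A| \<Longrightarrow> \<exists>U. separating_family B U"
  shows "\<exists>U. separating_family A U"
proof -
  have wo: "well_order_on A |A|" by (rule card_of_well_order_on)
  have infA: "infinite A"
    using large Cinfinite cinfinite_mono by (metis Field_card_of cinfinite_def)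
  text \<open>
    \<open>B' i\<close> is the successor of \<open>B i\<close> in the chain. The chain starts at \<open>Fhull gen {}\<close>, which
    need not be empty, so the family of this set has to be added.
  \<close>
  define below where "below = (\<lambda>i. underS (card_of A) i)"
  define B where "B = (\<lambda>i. Fhull gen (below i))"
  define B' where "B' = (\<lambda>i. Fhull gen (insert i (below i)))"
  have below_A: "below i \<subseteq> A" for i
    using Field_card_of[of A] by (auto simp: below_def underS_def Field_def)
  have below_trans: "insert j (below j) \<subseteq> below i" if "j \<in> below i" for i j
    using that wo
    unfolding below_def underS_def well_order_on_def linear_order_on_def partial_order_on_def
      preorder_on_def antisym_def trans_def by blast
  have below_total: "i \<in> below j \<or> j \<in> below i \<or> i = j" if "i \<in> A" "j \<in> A" for i j
    using that wo
    unfolding below_def underS_def well_order_on_def linear_order_on_def total_on_def by blast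
  have below_less: "|below i| <o |A|" if "i \<in> A" for i
    unfolding below_def using that by (intro card_of_underS[OF card_of_Card_order]) (simp add: Field_card_of)
  have insert_less: "|insert i (below i)| <o |A|" if "i \<in> A" for i
  proof -
    have "|{i}| <o |A|" by (rule ordLess_ordLeq_trans[OF finite_less large]) simp
    then have "|{i} \<union> below i| <o |A|" using below_less[OF that] infA by (intro card_of_Un_ordLess_infinite)
    then show ?thesis by simp
  qed
  have closed: "Fclosed gen (B i)" "Fclosed gen (B' i)" for i
    by (auto simp: B_def B'_def Fclosed_Fhull)
  have B_B': "B i \<subseteq> B' i" for i
    unfolding B_def B'_def by (intro Fhull_mono) auto
  have B'_B: "B' j \<subseteq> B i" if "j \<in> below i" for i j
    unfolding B_def B'_def using below_trans[OF that] by (rule Fhull_mono)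
  have dir: "\<exists>k\<in>J. B' i \<union> B' j \<subseteq> B' k" if "i \<in> J" "j \<in> J" "J \<subseteq> A" for J i j
  proof -
    have "i \<in> A" "j \<in> A" using that by auto
    from below_total[OF this] show ?thesis
    proof (elim disjE)
      assume "i \<in> below j"
      then have "B' i \<subseteq> B' j" using B'_B B_B' by (meson order_trans)
      then show ?thesis using that(2) by auto
    next
      assume "j \<in> below i"
      then have "B' j \<subseteq> B' i" using B'_B B_B' by (meson order_trans)
      then show ?thesis using that(1) by auto
    qed (use that(1) in auto)
  qed
  have union: "(\<Union>i\<in>A. B' i) = A"
  proof
    have "B' i \<subseteq> A" if "i \<in> A" for i
      unfolding B'_def using that below_A A by (intro Fhull_minimal) auto
    then show "(\<Union>i\<in>A. B' i) \<subseteq> A" by (rule UN_least)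
    have "i \<in> B' i" for i
      unfolding B'_def using subset_Fhull by (rule subsetD) simp
    then show "A \<subseteq> (\<Union>i\<in>A. B' i)" by (intro subsetI UN_I)
  qed
  \<comment> \<open>This treats successors and limits alike. The index set must be nonempty because
    the hull of the empty set can be nonempty.\<close>
  have B_union: "B i = (\<Union>j\<in>below i. B' j)" if "below i \<noteq> {}" for i
  proof
    show "(\<Union>j\<in>below i. B' j) \<subseteq> B i" using B'_B by blast
    have "j \<in> B' j" for j
      unfolding B'_def using subset_Fhull by (rule subsetD) simp
    then have "below i \<subseteq> (\<Union>j\<in>below i. B' j)" by (intro subsetI UN_I)
    then show "B i \<subseteq> (\<Union>j\<in>below i. B' j)"
      unfolding B_def
      by (rule Fhull_minimal[OF _ Fclosed_directed_Union[OF closed(2) that dir[OF _ _ below_A]]])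
  qed
  have B'_less: "|B' i| <o |A|" if "i \<in> A" for i
    unfolding B'_def using gen_less large insert_less[OF that] by (rule Fhull_less_large)
  have "|{} :: 'i set| <o |A|" by (rule ordLess_ordLeq_trans[OF finite_less large]) simp
  with gen_less large have "|Fhull gen {}| <o |A|" by (rule Fhull_less_large)
  then obtain U0 where U0: "separating_family (Fhull gen {}) U0"
    using IH[OF Fclosed_Fhull] by blast
  obtain V where V: "separating_family (B' i) (V i)" if "i \<in> A" for i
    using IH[OF closed(2) B'_less] by metis
  \<comment> \<open>Subtracting the value on \<open>B i\<close> makes each function vanish at every
    x whose support misses \<open>B' i - B i\<close>.\<close>
  define W where "W = (\<lambda>i. (\<lambda>u x. u (restr (B' i) x) - u (restr (B i) x)) ` V i)"
  define U where "U = U0 \<union> (\<Union>i\<in>A. W i)"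
  have "invariant_fun w" if w_in: "w \<in> W i" and i: "i \<in> A" for w i
  proof -
    obtain u where "u \<in> V i" and w: "w = (\<lambda>x. u (restr (B' i) x) - u (restr (B i) x))"
      using w_in by (auto simp: W_def)
    then have "invariant_fun u" using V[OF i] by (simp add: separating_family_def)
    then show ?thesis
      using invariant_fun_comp_restr[OF closed(1)[of i], of u] invariant_fun_comp_restr[OF closed(2)[of i], of u]
      unfolding w invariant_fun_def by (auto intro!: continuous_on_diff)
  qed
  then have "invariant_fun u" if "u \<in> U" for u
    using that U0 by (auto simp: U_def separating_family_def)
  moreover have "|{u \<in> U. u x \<noteq> 0}| <o \<kappa>" if x: "x \<in> C" for x
  proof -
    define I where "I = {i \<in> A. restr (B' i) x \<noteq> restr (B i) x}"
    have "\<exists>j. j \<in> B' i - B i \<and> x j \<noteq> 0" if i: "i \<in> I" for i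
    proof -
      obtain j where "restr (B' i) x j \<noteq> restr (B i) x j" using i by (auto simp: I_def)
      then show ?thesis using B_B'[of i] by (auto simp: restr_def split: if_splits)
    qed
    then obtain j where j: "\<And>i. i \<in> I \<Longrightarrow> j i \<in> B' i - B i" "\<And>i. i \<in> I \<Longrightarrow> x (j i) \<noteq> 0"
      by metis
    \<comment> \<open>The increments \<open>B' i - B i\<close> are pairwise disjoint, since
      \<open>B' i \<subseteq> B k\<close> whenever i precedes k. Hence \<open>I\<close> is no larger
      than the support of x.\<close>
    have "inj_on j I"
    proof (rule inj_onI)
      fix i k assume ik: "i \<in> I" "k \<in> I" "j i = j k"
      then show "i = k"
        using below_total[of i k] B'_B[of i k] B'_B[of k i] j(1)[OF ik(1)] j(1)[OF ik(2)]
        by (auto simp: I_def)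
    qed
    then have "|I| \<le>o |{i. x i \<noteq> 0}|"
      using j(2) by (intro card_of_ordLeqI[of j]) auto
    then have I: "|I| <o \<kappa>"
      using support_less[OF x] by (rule ordLeq_ordLess_trans)
    \<comment> \<open>A nonzero difference has a nonzero term, so point-smallness of
      \<open>V i\<close> is used at two points of \<open>C\<close>, the restrictions of x to
      \<open>B' i\<close> and to \<open>B i\<close>.\<close>
    let ?Z = "\<lambda>i. {u \<in> V i. u (restr (B' i) x) \<noteq> 0} \<union> {u \<in> V i. u (restr (B i) x) \<noteq> 0}"
    have "|\<Union>i\<in>I. (\<lambda>u x. u (restr (B' i) x) - u (restr (B i) x)) ` ?Z i| <o \<kappa>"
    proof (intro UN_less I image_less Un_less)
      fix i assume "i \<in> I"
      then have "separating_family (B' i) (V i)" using V by (simp add: I_def)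
      then show "|{u \<in> V i. u (restr (B' i) x) \<noteq> 0}| <o \<kappa>" "|{u \<in> V i. u (restr (B i) x) \<noteq> 0}| <o \<kappa>"
        using restr_in_C[OF closed(1) x] restr_in_C[OF closed(2) x]
        by (auto simp: separating_family_def)
    qed
    moreover have "|{u \<in> U0. u x \<noteq> 0}| <o \<kappa>"
      using U0 x by (auto simp: separating_family_def)
    ultimately have "|{u \<in> U0. u x \<noteq> 0} \<union> (\<Union>i\<in>I. (\<lambda>u x. u (restr (B' i) x) - u (restr (B i) x)) ` ?Z i)| <o \<kappa>"
      by (intro Un_less)
    then show ?thesis
      by (rule subset_less[rotated]) (auto simp: U_def W_def I_def)
  qed
  moreover have "\<exists>u\<in>U. u x \<noteq> u y"
    if x: "x \<in> C" and y: "y \<in> C" and xy: "(restr A x, restr A y) \<notin> E" for x y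
  proof (cases "(restr (Fhull gen {}) x, restr (Fhull gen {}) y) \<in> E")
    case False
    then have "\<exists>u\<in>U0. u x \<noteq> u y"
      using U0 x y unfolding separating_family_def by blast
    then show ?thesis by (auto simp: U_def)
  next
    case True
    define Q where "Q = {i \<in> A. (restr (B' i) x, restr (B' i) y) \<notin> E}"
    have "Q \<noteq> {}"
    proof
      assume "Q = {}"
      then have "(restr (\<Union>i\<in>A. B' i) x, restr (\<Union>i\<in>A. B' i) y) \<in> E"
        by (intro restr_directed_Union_in_E dir) (use infA in \<open>auto simp: Q_def\<close>)
      with xy union show False by simp
    qed
    moreover have "wf ( |A| - Id)" using wo by (simp add: well_order_on_def)
    ultimately obtain i where i: "i \<in> Q" "\<And>j. (j, i) \<in> |A| - Id \<Longrightarrow> j \<notin> Q"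
      using wfE_min'[of "|A| - Id" Q] by blast
    then have below_i: "j \<notin> Q" if "j \<in> below i" for j
      using that by (simp add: below_def underS_def)
    \<comment> \<open>By minimality of i the restrictions are equivalent at all earlier stages, and
      this passes to their union \<open>B i\<close>. The subtracted terms then agree for x and y, so
      the difference still separates them.\<close>
    have Bi: "(restr (B i) x, restr (B i) y) \<in> E"
    proof (cases "below i = {}")
      case True
      then show ?thesis
        using \<open>(restr (Fhull gen {}) x, restr (Fhull gen {}) y) \<in> E\<close> by (simp add: B_def)
    next
      case False
      then show ?thesis
        unfolding B_union[OF False] using below_i below_A[of i]
        by (intro restr_directed_Union_in_E dir[OF _ _ below_A]) (auto simp: Q_def)
    qed
    have iA: "i \<in> A" and B'i: "(restr (B' i) x, restr (B' i) y) \<notin> E" using i(1) by (auto simp: Q_def)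
    have "(restr (B' i) (restr (B' i) x), restr (B' i) (restr (B' i) y)) \<notin> E"
      using B'i by (simp add: restr_idem)
    then obtain u where u: "u \<in> V i" "u (restr (B' i) x) \<noteq> u (restr (B' i) y)"
      using V[OF iA] restr_in_C[OF closed(2) x, of i] restr_in_C[OF closed(2) y, of i]
      unfolding separating_family_def by blast
    moreover have "u (restr (B i) x) = u (restr (B i) y)"
      using V[OF iA] u(1) Bi unfolding separating_family_def invariant_fun_def by blast
    ultimately show ?thesis
      using iA unfolding U_def W_def
      by (intro bexI[of _ "\<lambda>x. u (restr (B' i) x) - u (restr (B i) x)"]) auto
  qed
  ultimately show ?thesis unfolding separating_family_def by blast
qed

lemma separating_family_exists:
  assumes "Fclosed gen A"
  shows "\<exists>U. separating_family A U"
  using assms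
proof (induction "|A|" arbitrary: A rule: wf_induct_rule[OF wf_ordLess])
  case (1 A)
  show ?case
  proof (cases "|A| <o \<kappa>")
    case True
    with "1.prems" show ?thesis by (rule separating_family_small)
  next
    case False
    then have "\<kappa> \<le>o |A|"
      by (rule iffD1[OF not_ordLess_iff_ordLeq
          [OF card_order_on_well_order_on[OF Card_order] card_of_Well_order]])
    with "1.prems" show ?thesis
    proof (rule separating_family_large)
      fix B assume "Fclosed gen B" "|B| <o |A|"
      then show "\<exists>U. separating_family B U" by (intro "1.hyps")
    qed
  qed
qed

lemma point_small_separating_family:
  "\<exists>U. (\<forall>u\<in>U. invariant_fun u) \<and>
     (\<forall>x\<in>C. |{u \<in> U. u x \<noteq> 0}| <o \<kappa>) \<and>
     (\<forall>x\<in>C. \<forall>y\<in>C. (x, y) \<notin> E \<longrightarrow> (\<exists>u\<in>U. u x \<noteq> u y))"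
  using separating_family_exists[of UNIV]
  by (simp add: Fclosed_def separating_family_def restr_def)

end

section \<open>Continuous images\<close>

text \<open>Evaluation at the members of \<open>\<Phi>\<close> is a continuous injection from a
  compact space into a Hausdorff one, hence an embedding; \<open>small\<close> puts its image into
  the sigma-product.\<close>

lemma kappa_Corson_compact_if_family:
  fixes X :: "'a topology" and \<Phi> :: "('a \<Rightarrow> real) set"
  assumes comp: "compact_space X" and Haus: "Hausdorff_space X"
    and cont: "\<And>\<phi>. \<phi> \<in> \<Phi> \<Longrightarrow> continuous_map X euclideanreal \<phi>"
    and small: "\<And>x. x \<in> topspace X \<Longrightarrow> |{\<phi> \<in> \<Phi>. \<phi> x \<noteq> 0}| <o \<kappa>"
    and sep: "\<And>x y. x \<in> topspace X \<Longrightarrow> y \<in> topspace X \<Longrightarrow> x \<noteq> y \<Longrightarrow> \<exists>\<phi>\<in>\<Phi>. \<phi> x \<noteq> \<phi> y"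
  shows "kappa_Corson_compact \<kappa> X"
proof -
  define g where "g = (\<lambda>x. \<lambda>\<phi>\<in>\<Phi>. \<phi> x)"
  have gS: "g x \<in> Sigma_prod \<kappa> \<Phi>" if "x \<in> topspace X" for x
  proof -
    have "{\<phi> \<in> \<Phi>. g x \<phi> \<noteq> 0} = {\<phi> \<in> \<Phi>. \<phi> x \<noteq> 0}"
      by (auto simp: g_def)
    with small[OF that] show ?thesis
      by (simp add: Sigma_prod_def) (simp add: g_def)
  qed
  have "continuous_map X (product_topology (\<lambda>_. euclideanreal) \<Phi>) g"
    unfolding continuous_map_componentwise by (auto simp: g_def cont)
  then have gcont: "continuous_map X (Sigma_space \<kappa> \<Phi>) g"
    using gS by (auto simp: Sigma_space_def continuous_map_in_subtopology)
  have ginj: "inj_on g (topspace X)"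
  proof (rule inj_onI, rule ccontr)
    fix x y assume "x \<in> topspace X" "y \<in> topspace X" and eq: "g x = g y" and "x \<noteq> y"
    then obtain \<phi> where "\<phi> \<in> \<Phi>" "\<phi> x \<noteq> \<phi> y" using sep by blast
    then show False using fun_cong[OF eq, of \<phi>] by (simp add: g_def)
  qed
  have "Hausdorff_space (Sigma_space \<kappa> \<Phi>)"
    by (auto simp: Sigma_space_def Hausdorff_space_product_topology
        intro!: Hausdorff_space_subtopology)
  then have "embedding_map X (Sigma_space \<kappa> \<Phi>) g"
    using continuous_imp_embedding_map gcont ginj comp by blast
  then have "X homeomorphic_space subtopology (Sigma_space \<kappa> \<Phi>) (g ` topspace X)"
    by (meson embedding_map_def homeomorphic_map_imp_homeomorphic_space)
  moreover have "g ` topspace X \<subseteq> topspace (Sigma_space \<kappa> \<Phi>)"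
    using gS by (auto simp: topspace_Sigma_space)
  ultimately show ?thesis
    using comp Haus unfolding kappa_Corson_compact_def by blast
qed

lemma prod_topology_euclidean: "prod_topology euclidean euclidean = euclidean"
  unfolding topology_eq openin_prod_topology_alt open_openin[symmetric] open_prod_def
  by (simp add: Ball_def)

lemma Hausdorff_space_euclidean_fun:
  "Hausdorff_space (euclidean :: ('i \<Rightarrow> real) topology)"
  unfolding euclidean_product_topology[symmetric] Hausdorff_space_product_topology by simp

lemma quotient_map_compact_Hausdorff:
  assumes "compact_space X" and "Hausdorff_space Y" and "continuous_map X Y f"
    and "f ` topspace X = topspace Y"
  shows "quotient_map X Y f"
  using assms continuous_imp_closed_map continuous_closed_imp_quotient_map by blast

theorem theorem9p2:
  fixes \<kappa> :: "'k rel" and K :: "'a topology" and L :: "'b topology" and f :: "'a \<Rightarrow> 'b"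
  assumes "Card_order \<kappa>" and "natLeq <o \<kappa>" and "regularCard \<kappa>"
    and "kappa_Corson_compact \<kappa> K"
    and "Hausdorff_space L"
    and "continuous_map K L f" and "f ` topspace K = topspace L"
  shows "kappa_Corson_compact \<kappa> L"
proof -
  interpret R: uncountable_regular \<kappa>
    using assms(1-3) by unfold_locales
  have compK: "compact_space K"
    using assms(4) by (simp add: kappa_Corson_compact_def)
  then have compL: "compact_space L"
    using image_compactin[OF _ assms(6), of "topspace K"] assms(7) by (simp add: compact_space_def)
  obtain \<Gamma> :: "('a \<Rightarrow> real) set" and S
    where S: "S \<subseteq> topspace (Sigma_space \<kappa> \<Gamma>)" "K homeomorphic_space subtopology (Sigma_space \<kappa> \<Gamma>) S"
    using assms(4) unfolding kappa_Corson_compact_def by blast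
  then obtain h where h: "homeomorphic_map K (subtopology (Sigma_space \<kappa> \<Gamma>) S) h"
    by (auto simp: homeomorphic_space)
  have hS: "h x \<in> Sigma_prod \<kappa> \<Gamma>" if "x \<in> topspace K" for x
    using homeomorphic_imp_surjective_map[OF h] that S by (auto simp: topspace_Sigma_space)
  have h_inj: "inj_on h (topspace K)"
    using homeomorphic_imp_injective_map[OF h] .
  have "continuous_map K (product_topology (\<lambda>_. euclideanreal) \<Gamma>) h"
    using homeomorphic_imp_continuous_map[OF h]
    by (simp add: Sigma_space_def subtopology_subtopology continuous_map_in_subtopology)
  then have h_cont: "continuous_map K euclideanreal (\<lambda>x. h x \<gamma>)" if "\<gamma> \<in> \<Gamma>" for \<gamma>
    using that by (simp add: continuous_map_componentwise)
  \<comment> \<open>Points of the sigma-product are \<open>undefined\<close> off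
    \<open>\<Gamma>\<close>. Extending by zero instead gives total functions with the same supports,
    so \<open>restr\<close> and the euclidean topology on the function type apply.\<close>
  define e where "e = (\<lambda>x \<gamma>. if \<gamma> \<in> \<Gamma> then h x \<gamma> else 0)"
  define C where "C = e ` topspace K"
  have e_cont: "continuous_map K euclidean e"
    unfolding euclidean_product_topology[symmetric] continuous_map_componentwise_UNIV
  proof
    show "continuous_map K euclideanreal (\<lambda>x. e x \<gamma>)" for \<gamma>
      by (cases "\<gamma> \<in> \<Gamma>") (simp_all add: e_def h_cont)
  qed
  have e_inj: "inj_on e (topspace K)"
  proof (rule inj_onI)
    fix x y assume x: "x \<in> topspace K" and y: "y \<in> topspace K" and eq: "e x = e y"
    have "h x \<gamma> = h y \<gamma>" if "\<gamma> \<in> \<Gamma>" for \<gamma>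
      using fun_cong[OF eq, of \<gamma>] that by (simp add: e_def)
    then have "h x = h y"
      using hS[OF x] hS[OF y] by (auto simp: Sigma_prod_def intro: PiE_ext)
    then show "x = y" using h_inj x y by (auto dest: inj_onD)
  qed
  have e_quot: "quotient_map K (top_of_set C) e"
    using e_cont compK Hausdorff_space_euclidean_fun
    by (intro quotient_map_compact_Hausdorff Hausdorff_space_subtopology)
      (auto simp: continuous_map_in_subtopology C_def)
  \<comment> \<open>The kernel of \<open>f\<close>, closed because \<open>L\<close> is Hausdorff;
    \<open>E\<close> is its image in \<open>C \<times> C\<close>.\<close>
  define T where "T = {p \<in> topspace (prod_topology K K). (f \<circ> fst) p = (f \<circ> snd) p}"
  define E where "E = (\<lambda>p. (e (fst p), e (snd p))) ` T"
  have "closedin (prod_topology K K) T"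
    unfolding T_def using assms(5,6)
    by (intro closedin_continuous_maps_eq continuous_map_compose[where X' = K] continuous_map_fst continuous_map_snd)
  then have "compactin (prod_topology K K) T"
    using compK by (intro closedin_compact_space) (simp_all add: compact_space_prod_topology)
  moreover have "continuous_map (prod_topology K K) euclidean (\<lambda>p. (e (fst p), e (snd p)))"
    unfolding prod_topology_euclidean[symmetric]
    using continuous_map_compose[OF continuous_map_fst e_cont]
      continuous_map_compose[OF continuous_map_snd e_cont]
    by (intro continuous_map_pairedI) (simp_all add: o_def)
  ultimately have compE: "compact E"
    unfolding E_def using image_compactin compactin_euclidean_iff by blast
  have E_iff: "(e x, e y) \<in> E \<longleftrightarrow> f x = f y" if "x \<in> topspace K" "y \<in> topspace K" for x y
    using that inj_onD[OF e_inj] unfolding E_def T_def by (auto simp: image_iff)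
  interpret Q: sigma_quotient \<kappa> C E
  proof
    show "compact E" by (fact compE)
    show "E \<subseteq> C \<times> C" by (auto simp: E_def T_def C_def)
    show "(x, x) \<in> E" if "x \<in> C" for x
      using that by (auto simp: C_def E_iff)
    show "|{i. x i \<noteq> 0}| <o \<kappa>" if x: "x \<in> C" for x
    proof -
      obtain a where a: "a \<in> topspace K" "x = e a" using x by (auto simp: C_def)
      then have "{i. x i \<noteq> 0} = {\<gamma> \<in> \<Gamma>. h a \<gamma> \<noteq> 0}" by (auto simp: e_def)
      then show ?thesis using hS[OF a(1)] by (simp add: Sigma_prod_def)
    qed
    fix x y assume "x \<in> C" "y \<in> C" "(x, y) \<notin> E"
    then obtain a b where ab: "a \<in> topspace K" "b \<in> topspace K" "x = e a" "y = e b" "f a \<noteq> f b"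
      by (auto simp: C_def E_iff)
    then have fL: "f a \<in> topspace L" "f b \<in> topspace L" using assms(7) by auto
    have "normal_space L"
      using compL assms(5) compact_Hausdorff_or_regular_imp_normal_space by blast
    moreover have "closedin L {f a}" "closedin L {f b}" "disjnt {f a} {f b}"
      using fL ab(5) assms(5) by (auto simp: closedin_Hausdorff_sing_eq)
    ultimately obtain \<phi> :: "'b \<Rightarrow> real" where \<phi>: "continuous_map L (top_of_set {0..1}) \<phi>"
      "\<phi> ` {f a} \<subseteq> {0}" "\<phi> ` {f b} \<subseteq> {1}"
      unfolding normal_space_iff_Urysohn by metis
    \<comment> \<open>This transports \<open>\<phi> \<circ> f\<close> from \<open>K\<close> to
      \<open>C\<close>, using injectivity of \<open>e\<close>. Continuity follows since
      \<open>e\<close> is a quotient map onto \<open>C\<close> and \<open>u \<circ> e\<close> agrees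
      with \<open>\<phi> \<circ> f\<close>.\<close>
    define u where "u = (\<lambda>z. \<phi> (f (inv_into (topspace K) e z)))"
    have u_e: "u (e x) = \<phi> (f x)" if "x \<in> topspace K" for x
      using that e_inj by (simp add: u_def)
    have "continuous_map K euclideanreal (\<phi> \<circ> f)"
      using \<phi>(1) assms(6) by (intro continuous_map_compose) (auto simp: continuous_map_in_subtopology)
    then have "continuous_map K euclideanreal (u \<circ> e)"
      by (rule continuous_map_eq) (simp add: u_e)
    then have "continuous_map (top_of_set C) euclideanreal u"
      by (rule continuous_compose_quotient_map[OF e_quot])
    then have "continuous_on C u" by simp
    moreover have "u p = u q" if "(p, q) \<in> E" for p q
      using that by (auto simp: E_def T_def u_e)
    moreover have "u x \<noteq> u y"
      using \<phi>(2,3) ab by (simp add: u_e)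
    ultimately show "\<exists>u :: _ \<Rightarrow> real. continuous_on C u \<and> (\<forall>p q. (p, q) \<in> E \<longrightarrow> u p = u q) \<and> u x \<noteq> u y"
      by blast
  qed
  obtain U where inv: "\<forall>u\<in>U. Q.invariant_fun u"
    and small: "\<forall>x\<in>C. |{u \<in> U. u x \<noteq> 0}| <o \<kappa>"
    and sep: "\<forall>x\<in>C. \<forall>y\<in>C. (x, y) \<notin> E \<longrightarrow> (\<exists>u\<in>U. u x \<noteq> u y)"
    using Q.point_small_separating_family by blast
  \<comment> \<open>An arbitrary section of \<open>f\<close>, in general discontinuous. Invariance
    gives \<open>v u \<circ> f = u \<circ> e\<close> on \<open>K\<close>, so \<open>v u\<close> is
    continuous because \<open>f\<close> is a quotient map.\<close>
  define r where "r = inv_into (topspace K) f"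
  have r: "r y \<in> topspace K" "f (r y) = y" if "y \<in> topspace L" for y
    using that assms(7) by (auto simp: r_def inv_into_into f_inv_into_f)
  define v where "v = (\<lambda>u y. u (e (r y)) :: real)"
  have f_quot: "quotient_map K L f"
    using compK assms(5-7) by (rule quotient_map_compact_Hausdorff)
  show ?thesis
  proof (rule kappa_Corson_compact_if_family[OF compL assms(5), of "v ` U"])
    fix \<phi> assume "\<phi> \<in> v ` U"
    then obtain u where u: "u \<in> U" "\<phi> = v u" by blast
    have "continuous_map (top_of_set C) euclideanreal u"
      using inv u(1) by (simp add: Q.invariant_fun_def)
    moreover have "continuous_map K (top_of_set C) e"
      using e_quot by (rule quotient_imp_continuous_map)
    ultimately have "continuous_map K euclideanreal (u \<circ> e)"
      by (rule continuous_map_compose[rotated])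
    moreover have "(u \<circ> e) x = (\<phi> \<circ> f) x" if x: "x \<in> topspace K" for x
    proof -
      have "f x \<in> topspace L" using x assms(7) by auto
      from r[OF this] x have "(e x, e (r (f x))) \<in> E" by (simp add: E_iff)
      with inv u(1) show ?thesis by (simp add: u(2) v_def Q.invariant_fun_def)
    qed
    ultimately have "continuous_map K euclideanreal (\<phi> \<circ> f)" by (rule continuous_map_eq)
    then show "continuous_map L euclideanreal \<phi>"
      by (rule continuous_compose_quotient_map[OF f_quot])
  next
    fix y assume "y \<in> topspace L"
    then have "e (r y) \<in> C" using r by (simp add: C_def)
    with small have "|{u \<in> U. u (e (r y)) \<noteq> 0}| <o \<kappa>" by blast
    from R.image_less[OF this, of v]
    show "|{\<phi> \<in> v ` U. \<phi> y \<noteq> 0}| <o \<kappa>"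
      by (rule R.subset_less[rotated]) (auto simp: v_def)
  next
    fix y z assume yz: "y \<in> topspace L" "z \<in> topspace L" "y \<noteq> z"
    then have "e (r y) \<in> C" "e (r z) \<in> C" "(e (r y), e (r z)) \<notin> E"
      using r by (simp_all add: C_def E_iff)
    with sep show "\<exists>\<phi>\<in>v ` U. \<phi> y \<noteq> \<phi> z"
      by (simp add: v_def)
  qed
qed

end
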